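(* Let $A, X \in \mathbb{C}^{m \times n}$ and $W \in \mathbb{C}^{n \times m}$. Then the following statements are equivalent. (i) $X \in A\{1',2',4'\}$. (ii) $r(WAW)=r(A)$, $XWAWX=X$, and $\mathcal{R}(X)=\mathcal{R}((AW)^* )$. (iii) $r(WAW)=r(A)$, $AWXWA=A$, and $\mathcal{R}(X)=\mathcal{R}((AW)^* )$.
   Context: $r(\cdot)$ denotes rank, $\mathcal{R}(\cdot)$ range (column space), $*$ conjugate transpose. For $A \in \mathbb{C}^{m \times n}$, $W \in \mathbb{C}^{n \times m}$, $A\{1',2',4'\}$ is the set of all $X \in \mathbb{C}^{m \times n}$ with $AWXWA=A$, $XWAWX=X$ and $(XWAW)^*=XWAW$. *)

theory Defs
  imports "HOL-Analysis.Analysis"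
begin

text \<open>
  An \<open>m \<times> n\<close> complex matrix has type \<open>complex^'n^'m\<close>. The library's \<^const>\<open>rank\<close> is the
  dimension over the scalar field (here the complex numbers, via \<open>vec.dim\<close>) of the span of the
  rows, and the column space of \<open>M\<close> is \<open>range ((*v) M)\<close>.
\<close>

definition conj_transpose :: "complex^'n^'m \<Rightarrow> complex^'m^'n"
  where "conj_transpose M = map_matrix cnj (transpose M)"

text \<open>
  The set \<open>A{1',2',4'}\<close>. It depends on the weight \<open>W\<close>, which the usual notation suppresses.
\<close>

definition weighted_124_inverses :: "complex^'n^'m \<Rightarrow> complex^'m^'n \<Rightarrow> (complex^'n^'m) set"
  where "weighted_124_inverses A W =
    {X. A ** W ** X ** W ** A = A \<and>
        X ** W ** A ** W ** X = X \<and>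
        conj_transpose (X ** W ** A ** W) = X ** W ** A ** W}"

end

theory Submission
  imports Defs
begin

text \<open>
  Put \<open>B = AW\<close> and \<open>P = XWB\<close>. If \<open>\<R>(X) = \<R>(B\<^sup>*)\<close>, then \<open>XWBX = X\<close> yields \<open>PB\<^sup>* = B\<^sup>*\<close>, hence
  \<open>BP\<^sup>* = B\<close> and \<open>PP\<^sup>* = P\<close>; so \<open>P\<close> is Hermitian and \<open>BP = B\<close>. Conversely \<open>BP = B\<close> yields
  \<open>B(PX - X) = 0\<close>, where the columns of \<open>PX - X\<close> lie in \<open>\<R>(B\<^sup>*)\<close>, the orthogonal complement of the
  kernel of \<open>B\<close>. The rank condition amounts to \<open>\<R>(AW) = \<R>(A)\<close>, which cancels a \<open>W\<close> on the right
  of \<open>AWXWAW = AW\<close>.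
\<close>

section \<open>Rank over a field\<close>

lemma subspace_range_matrix:
  fixes M :: "'a::field^'n^'m"
  shows "vec.subspace (range ((*v) M))"
  by (rule vec.subspace_image[OF vec.subspace_UNIV])

text \<open>This links \<open>rank\<close>, which is row-based, to ranges: row \<open>i\<close> of
  \<open>M\<close> is the image of the \<open>i\<close>-th unit vector under
  \<open>transpose M\<close>.\<close>

lemma range_transpose_eq_span_rows:
  fixes M :: "'a::field^'n^'m"
  shows "range ((*v) (transpose M)) = vec.span (rows M)"
proof
  show "range ((*v) (transpose M)) \<subseteq> vec.span (rows M)"
    using matrix_vector_mult_in_columnspace_gen[of "transpose M"] by (auto simp: columns_transpose)
  have "row i M = transpose M *v axis i 1" for i
    by (simp add: vec_eq_iff matrix_vector_mult_def transpose_def row_def axis_def if_distrib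
        cong: if_cong)
  then have "rows M \<subseteq> range ((*v) (transpose M))"
    by (auto simp: rows_def)
  moreover have "vec.subspace (range ((*v) (transpose M)))"
    by (rule subspace_range_matrix)
  ultimately show "vec.span (rows M) \<subseteq> range ((*v) (transpose M))"
    by (simp add: vec.span_minimal)
qed

lemma rank_transpose_eq_dim_range:
  fixes M :: "'a::field^'n^'m"
  shows "rank (transpose M) = vec.dim (range ((*v) M))"
  using range_transpose_eq_span_rows[of "transpose M"]
  by (simp add: row_rank_def_gen vec.dim_span)

text \<open>Expanding every column in a basis \<open>B\<close> of the column space factors
  \<open>M\<close> through a space of dimension \<open>card B\<close>, so \<open>card B\<close>
  coefficient vectors span the rows. Applied to \<open>transpose M\<close> as well, this gives
  equality of row and column rank.\<close>

lemma rank_le_rank_transpose: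
  fixes M :: "'a::field^'n^'m"
  shows "rank M \<le> rank (transpose M)"
proof -
  obtain B where B: "B \<subseteq> columns M" "vec.independent B" "columns M \<subseteq> vec.span B"
    "card B = vec.dim (columns M)"
    using vec.basis_exists[of "columns M"] by blast
  have fin: "finite B"
    using B(2) vec.finiteI_independent by blast
  have "\<exists>u. column j M = (\<Sum>b\<in>B. u b *s b)" for j
    using B(3) vec.span_finite[OF fin] by (auto simp: columns_def)
  then obtain u where u: "\<And>j. column j M = (\<Sum>b\<in>B. u j b *s b)"
    by metis
  \<comment> \<open>The same expansion read along row \<open>i\<close>: the entries
    \<open>b $ i\<close> now act as scalars on the coefficient vectors.\<close>
  have "row i M = (\<Sum>b\<in>B. b $ i *s (\<chi> j. u j b))" for i
  proof -
    have "M $ i $ j = (\<Sum>b\<in>B. u j b * b $ i)" for j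
      using arg_cong[OF u[of j], of "\<lambda>v. v $ i"] by (simp add: column_def)
    then show ?thesis
      by (simp add: vec_eq_iff row_def mult.commute)
  qed
  then have "rows M \<subseteq> vec.span ((\<lambda>b. \<chi> j. u j b) ` B)"
    by (auto simp: rows_def intro!: vec.span_sum vec.span_scale intro: vec.span_base)
  then have "rank M \<le> card ((\<lambda>b. \<chi> j. u j b) ` B)"
    unfolding row_rank_def_gen using fin by (intro vec.dim_le_card) auto
  also have "\<dots> \<le> card B"
    using fin by (rule card_image_le)
  also have "\<dots> = rank (transpose M)"
    using B(4) by (simp add: row_rank_def_gen rows_transpose)
  finally show ?thesis .
qed

lemma rank_eq_dim_range:
  fixes M :: "'a::field^'n^'m"
  shows "rank M = vec.dim (range ((*v) M))"
  using rank_le_rank_transpose[of M] rank_le_rank_transpose[of "transpose M"]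
  by (simp add: rank_transpose_eq_dim_range[symmetric])

lemma range_matrix_mult_subset:
  fixes M :: "'a::comm_semiring_1^'n^'m" and N :: "'a^'p^'n"
  shows "range ((*v) (M ** N)) \<subseteq> range ((*v) M)"
  by (auto simp: matrix_vector_mul_assoc[symmetric])

lemma rank_matrix_mult_le_left:
  fixes M :: "'a::field^'n^'m" and N :: "'a^'p^'n"
  shows "rank (M ** N) \<le> rank M"
  unfolding rank_eq_dim_range by (intro vec.dim_subset range_matrix_mult_subset)

lemma rank_matrix_mult_le_right:
  fixes M :: "'a::field^'n^'m" and N :: "'a^'p^'n"
  shows "rank (M ** N) \<le> rank N"
proof -
  have "range ((*v) (M ** N)) = (*v) M ` range ((*v) N)"
    by (simp add: image_image matrix_vector_mul_assoc)
  then show ?thesis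
    by (simp add: rank_eq_dim_range vec.dim_image_le)
qed

text \<open>Each column of \<open>M\<close> has a preimage under \<open>N\<close>; these preimages
  are the columns of \<open>Y\<close>.\<close>

lemma range_subset_imp_right_factor:
  fixes M :: "'a::comm_semiring_1^'n^'m" and N :: "'a^'p^'m"
  assumes "range ((*v) M) \<subseteq> range ((*v) N)"
  obtains Y where "M = N ** Y"
proof -
  have "column j M = M *v axis j 1" for j
    by (simp add: vec_eq_iff matrix_vector_mult_def column_def axis_def if_distrib cong: if_cong)
  then have "\<forall>j. \<exists>y. column j M = N *v y"
    using assms by (metis rangeE rangeI subsetD)
  then obtain y where y: "\<And>j. column j M = N *v y j"
    by metis
  have "M $ i $ j = (N *v y j) $ i" for i j
    using y[of j] by (simp add: vec_eq_iff column_def)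
  then have "M = N ** (\<chi> k j. y j $ k)"
    by (simp add: vec_eq_iff matrix_matrix_mult_def matrix_vector_mult_def)
  then show thesis
    by (rule that)
qed

text \<open>The range of \<open>M ** N\<close> lies in that of \<open>M\<close>, and the rank bound
  forces the two subspaces to coincide.\<close>

lemma rank_mult_eq_imp_right_factor:
  fixes M :: "'a::field^'n^'m" and N :: "'a^'p^'n"
  assumes "rank M \<le> rank (M ** N)"
  obtains Y where "M = M ** N ** Y"
proof -
  have "range ((*v) (M ** N)) = range ((*v) M)"
    using assms range_matrix_mult_subset[of M N]
    by (intro vec.subspace_dim_equal) (auto simp: rank_eq_dim_range subspace_range_matrix)
  then show thesis
    using range_subset_imp_right_factor that by (metis order_refl)
qed

section \<open>Conjugate transpose\<close>

lemma conj_transpose_mult: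
  "conj_transpose (M ** N) = conj_transpose N ** conj_transpose M"
  by (simp add: conj_transpose_def vec_eq_iff matrix_matrix_mult_def transpose_def mult.commute)

lemma conj_transpose_conj_transpose [simp]: "conj_transpose (conj_transpose M) = M"
  by (simp add: conj_transpose_def vec_eq_iff transpose_def)

text \<open>Here the inner product is the real part of the Hermitian one. It is still definite,
  which is enough for showing that a vector vanishes.\<close>

lemma inner_matrix_vector_mult_conj_transpose:
  "(M *v x) \<bullet> y = x \<bullet> (conj_transpose M *v y)"
proof -
  have "(M *v x) \<bullet> y = (\<Sum>i\<in>UNIV. \<Sum>j\<in>UNIV. Re (M $ i $ j * x $ j * cnj (y $ i)))"
    by (simp add: inner_vec_def matrix_vector_mult_def inner_complex_def sum_distrib_right
        sum.distrib[symmetric])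
  also have "\<dots> = (\<Sum>j\<in>UNIV. \<Sum>i\<in>UNIV. Re (M $ i $ j * x $ j * cnj (y $ i)))"
    by (rule sum.swap)
  also have "\<dots> = x \<bullet> (conj_transpose M *v y)"
    by (simp add: inner_vec_def matrix_vector_mult_def inner_complex_def sum_distrib_left
        conj_transpose_def transpose_def sum.distrib[symmetric])
      (simp add: algebra_simps)
  finally show ?thesis .
qed

lemma mult_conj_transpose_cancel_left:
  assumes "M ** conj_transpose M ** Y = 0"
  shows "conj_transpose M ** Y = 0"
proof -
  have "conj_transpose M *v (Y *v v) = 0" for v
  proof -
    let ?y = "conj_transpose M *v (Y *v v)"
    have "?y \<bullet> ?y = (M *v ?y) \<bullet> (Y *v v)"
      by (simp add: inner_matrix_vector_mult_conj_transpose)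
    also have "M *v ?y = 0"
      using assms by (simp add: matrix_vector_mul_assoc matrix_mul_assoc)
    finally show ?thesis
      by simp
  qed
  then show ?thesis
    by (simp add: matrix_eq matrix_vector_mul_assoc)
qed

section \<open>Weighted inverses\<close>

lemma weighted_124_inverse_rank:
  assumes "X \<in> weighted_124_inverses A W"
  shows "rank (W ** A ** W) = rank A"
proof (rule antisym)
  have "rank (W ** A ** W) \<le> rank (W ** A)"
    by (rule rank_matrix_mult_le_left)
  then show "rank (W ** A ** W) \<le> rank A"
    using rank_matrix_mult_le_right[of W A] by linarith
  have A: "A ** W ** X ** W ** A = A" and X: "X ** W ** A ** W ** X = X"
    using assms by (auto simp: weighted_124_inverses_def)
  \<comment> \<open>Inserting \<open>A = AWXWA\<close> into itself exposes \<open>WAW\<close> as a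
    factor.\<close>
  have "A = A ** W ** X ** (W ** A ** W) ** (X ** W ** A)"
    using A X by (metis matrix_mul_assoc)
  then have "rank A \<le> rank (A ** W ** X ** (W ** A ** W))"
    by (metis rank_matrix_mult_le_left)
  also have "\<dots> \<le> rank (W ** A ** W)"
    by (rule rank_matrix_mult_le_right)
  finally show "rank A \<le> rank (W ** A ** W)" .
qed

lemma weighted_124_inverse_range:
  assumes "X \<in> weighted_124_inverses A W"
  shows "range ((*v) X) = range ((*v) (conj_transpose (A ** W)))"
proof
  let ?B = "A ** W" and ?P = "X ** W ** A ** W"
  have A: "A ** W ** X ** W ** A = A" and X: "?P ** X = X" and P: "conj_transpose ?P = ?P"
    using assms by (auto simp: weighted_124_inverses_def)
  \<comment> \<open>As \<open>?P\<close> is Hermitian, it equals the conjugate transpose of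
    \<open>(XW)(AW)\<close>, which starts with that of \<open>?B\<close>.\<close>
  have "?P = conj_transpose ?B ** conj_transpose (X ** W)"
    using P by (metis conj_transpose_mult matrix_mul_assoc)
  then have "X = conj_transpose ?B ** (conj_transpose (X ** W) ** X)"
    using X by (metis matrix_mul_assoc)
  then show "range ((*v) X) \<subseteq> range ((*v) (conj_transpose ?B))"
    by (metis range_matrix_mult_subset)
  have "?B ** ?P = ?B"
    using A by (simp add: matrix_mul_assoc)
  \<comment> \<open>Conjugate transposition of \<open>?B ** ?P = ?B\<close> gives
    \<open>?P ** conj_transpose ?B = conj_transpose ?B\<close>, and \<open>?P\<close> starts with
    \<open>X\<close>.\<close>
  then have "conj_transpose ?B = X ** (W ** A ** W ** conj_transpose ?B)"
    using P by (metis conj_transpose_mult matrix_mul_assoc)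
  then show "range ((*v) (conj_transpose ?B)) \<subseteq> range ((*v) X)"
    by (metis range_matrix_mult_subset)
qed

lemma weighted_124_inverseI:
  assumes rank: "rank (W ** A ** W) = rank A"
    and X: "X ** W ** A ** W ** X = X"
    and range: "range ((*v) X) = range ((*v) (conj_transpose (A ** W)))"
  shows "X \<in> weighted_124_inverses A W"
proof -
  let ?B = "A ** W" and ?P = "X ** W ** A ** W"
  obtain Z where Z: "conj_transpose ?B = X ** Z"
    using range range_subset_imp_right_factor by (metis order_refl)
  have "?P ** conj_transpose ?B = conj_transpose ?B"
    using X Z by (metis matrix_mul_assoc)
  then have BP: "?B ** conj_transpose ?P = ?B"
    by (metis conj_transpose_mult conj_transpose_conj_transpose)
  \<comment> \<open>Multiply by \<open>X ** W\<close> on the left, since \<open>?P\<close> is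
    \<open>X ** W\<close> times \<open>?B\<close>.\<close>
  then have "?P ** conj_transpose ?P = ?P"
    by (metis matrix_mul_assoc)
  then have P: "conj_transpose ?P = ?P"
    by (metis conj_transpose_mult conj_transpose_conj_transpose)
  have "rank A \<le> rank ?B"
    using rank rank_matrix_mult_le_right[of W ?B] by (simp add: matrix_mul_assoc)
  then obtain Y where Y: "A = ?B ** Y"
    by (rule rank_mult_eq_imp_right_factor)
  \<comment> \<open>Only the last \<open>A\<close> is replaced by \<open>?B ** Y\<close>, which
    completes the factor \<open>?P\<close>.\<close>
  have "A ** W ** X ** W ** A = ?B ** ?P ** Y"
    by (subst (2) Y) (simp add: matrix_mul_assoc)
  also have "\<dots> = A"
    using BP P Y by metis
  finally show ?thesis
    using X P by (simp add: weighted_124_inverses_def)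
qed

lemma matrix_mult_diff_distrib:
  fixes M :: "'a::ring_1^'n^'m" and N L :: "'a^'p^'n"
  shows "M ** (N - L) = M ** N - M ** L"
  by (simp add: vec_eq_iff matrix_matrix_mult_def right_diff_distrib sum_subtractf)

lemma inner_inverse_imp_outer_inverse:
  assumes A: "A ** W ** X ** W ** A = A"
    and range: "range ((*v) X) \<subseteq> range ((*v) (conj_transpose (A ** W)))"
  shows "X ** W ** A ** W ** X = X"
proof -
  let ?B = "A ** W"
  obtain Y where Y: "X = conj_transpose ?B ** Y"
    using range range_subset_imp_right_factor by blast
  \<comment> \<open>\<open>V\<close> is a preimage of the defect \<open>XWAWX - X\<close> under
    \<open>conj_transpose ?B\<close>, obtained by replacing the leading \<open>X\<close> of each
    term by \<open>Y\<close>.\<close>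
  define V where "V = Y ** W ** A ** W ** X - Y"
  have V: "conj_transpose ?B ** V = X ** W ** A ** W ** X - X"
    unfolding V_def matrix_mult_diff_distrib matrix_mul_assoc Y[symmetric] ..
  have "?B ** conj_transpose ?B ** V = ?B ** (X ** W ** A ** W ** X - X)"
    using V by (metis matrix_mul_assoc)
  also have "\<dots> = 0"
    using A by (simp add: matrix_mult_diff_distrib matrix_mul_assoc)
  finally have "conj_transpose ?B ** V = 0"
    by (rule mult_conj_transpose_cancel_left)
  then show ?thesis
    using V by simp
qed

theorem theorem2p8:
  fixes A X :: "complex^'n^'m" and W :: "complex^'m^'n"
  shows "(X \<in> weighted_124_inverses A W \<longleftrightarrow>
            rank (W ** A ** W) = rank A \<and>
            X ** W ** A ** W ** X = X \<and>
            range ((*v) X) = range ((*v) (conj_transpose (A ** W))))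
       \<and> (X \<in> weighted_124_inverses A W \<longleftrightarrow>
            rank (W ** A ** W) = rank A \<and>
            A ** W ** X ** W ** A = A \<and>
            range ((*v) X) = range ((*v) (conj_transpose (A ** W))))"
proof -
  have "A ** W ** X ** W ** A = A" "X ** W ** A ** W ** X = X"
    if "X \<in> weighted_124_inverses A W"
    using that by (auto simp: weighted_124_inverses_def)
  then show ?thesis
    using weighted_124_inverse_rank[of X A W] weighted_124_inverse_range[of X A W]
      weighted_124_inverseI[of W A X] inner_inverse_imp_outer_inverse[of A W X]
    by blast
qed

end
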